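(* Let $n\ge 1$, $s\in(1/4,1)$, and let $q\in L^\infty(\mathbb{R}^n)$ (possibly complex valued) satisfy $|q(x)|\le 1$ for a.e. $x$. Let $u\in H^s(\mathbb{R}^n;\mathbb{C})$ be a solution of $((-\Delta)^s+q)u=0$ in $\mathbb{R}^n$. Suppose there exist $\alpha>\frac{4s}{4s-1}$ and $C<\infty$ such that $$\int_{\mathbb{R}^n} e^{|x|^{\alpha}}|u(x)|^2\,dx\le C.$$ Then $u\equiv 0$.
   Context: $(-\Delta)^s$ denotes the fractional Laplacian on $\mathbb{R}^n$ (Fourier multiplier $|\xi|^{2s}$), and $H^s(\mathbb{R}^n;\mathbb{C})$ the standard complex-valued Sobolev space of order $s$. The equation is understood in the weak sense. *)

theory Defs
  imports "HOL-Analysis.Analysis"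
begin

definition L1fun :: "('a::euclidean_space \<Rightarrow> complex) \<Rightarrow> bool" where
  "L1fun u \<longleftrightarrow> integrable lborel u"

definition L2fun :: "('a::euclidean_space \<Rightarrow> complex) \<Rightarrow> bool" where
  "L2fun u \<longleftrightarrow> u \<in> borel_measurable lborel \<and> integrable lborel (\<lambda>x. (norm (u x))\<^sup>2)"

definition fourier_L1 :: "('a::euclidean_space \<Rightarrow> complex) \<Rightarrow> 'a \<Rightarrow> complex" where
  "fourier_L1 f \<xi> = (LINT x|lborel. f x * cis (- (x \<bullet> \<xi>)))"

text \<open>v is (a representative of) the L^2 (Plancherel) Fourier transform of u, characterised by duality
 \<open>\<integral> u \<phi>^ = \<integral> v \<phi>\<close> for all \<open>\<phi> \<in> L^1 \<inter> L^2\<close>.\<close>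
definition fourier_L2 :: "('a::euclidean_space \<Rightarrow> complex) \<Rightarrow> ('a \<Rightarrow> complex) \<Rightarrow> bool" where
  "fourier_L2 u v \<longleftrightarrow> L2fun u \<and> L2fun v \<and>
     (\<forall>\<phi>. L1fun \<phi> \<and> L2fun \<phi> \<longrightarrow>
        (LINT x|lborel. u x * fourier_L1 \<phi> x) = (LINT \<xi>|lborel. v \<xi> * \<phi> \<xi>))"

definition Hs_fourier :: "real \<Rightarrow> ('a::euclidean_space \<Rightarrow> complex) \<Rightarrow> ('a \<Rightarrow> complex) \<Rightarrow> bool" where
  "Hs_fourier s u v \<longleftrightarrow> fourier_L2 u v \<and>
     integrable lborel (\<lambda>\<xi>. (1 + (norm \<xi>)\<^sup>2) powr s * (norm (v \<xi>))\<^sup>2)"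

definition in_Hs :: "real \<Rightarrow> ('a::euclidean_space \<Rightarrow> complex) \<Rightarrow> bool" where
  "in_Hs s u \<longleftrightarrow> (\<exists>v. Hs_fourier s u v)"

definition frac_weak_solution ::
  "real \<Rightarrow> ('a::euclidean_space \<Rightarrow> complex) \<Rightarrow> ('a \<Rightarrow> complex) \<Rightarrow> bool" where
  "frac_weak_solution s q u \<longleftrightarrow>
     (\<forall>v \<phi> w. Hs_fourier s u v \<longrightarrow> Hs_fourier s \<phi> w \<longrightarrow>
        complex_of_real (1 / (2 * pi) ^ DIM('a)) *
          (LINT \<xi>|lborel. complex_of_real ((norm \<xi>) powr (2 * s)) * v \<xi> * cnj (w \<xi>))
        + (LINT x|lborel. q x * u x * cnj (\<phi> x)) = 0)"

end

(*
The decay of u makes the Fourier transforms U of u and G of qu entire along every real line through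
the origin, and the equation reads |xi|^(2s) U = -G pointwise, as one sees by testing with Gaussians.
Since 0 < 2s < 2, the factor |t|^(2s) is not a quotient of convergent power series at t = 0, so
U vanishes on every line, hence u = 0.
*)
theory Submission
  imports Defs "HOL-Probability.Probability" "HOL-Real_Asymp.Real_Asymp"
begin

section \<open>Integration on Euclidean space\<close>

text \<open>A line through the origin is a null set once the dimension exceeds 1, so an
  almost-everywhere identity between Plancherel transforms could not be restricted to it; the
  equation is wanted at every frequency. The decay makes u and q u integrable, so both transforms
  are continuous functions \<open>fourier_L1\<close>, and a continuous function of at most quadratic
  growth is recovered at a point from its integrals against Gaussians shrinking to that point.
  Quadratic growth has to be allowed because of the factor |xi|^(2s). Gaussians are at once H^s test
  functions, functions whose transform inverts by direct computation, and an approximate identity.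
  The same family, through the multiplication formula, shows that an integrable function with
  vanishing transform is zero almost everywhere. Working line by line replaces holomorphy in several
  variables by power series in one real parameter, whose coefficients are moments of u and q
  u.\<close>

lemma has_bochner_integral_prod_Basis:
  fixes f :: "'a::euclidean_space \<Rightarrow> real \<Rightarrow> complex"
  assumes f: "\<And>b. b \<in> Basis \<Longrightarrow> has_bochner_integral lborel (f b) (I b)"
  shows "has_bochner_integral lborel (\<lambda>x::'a. \<Prod>b\<in>Basis. f b (x \<bullet> b)) (\<Prod>b\<in>Basis. I b)"
proof -
  interpret product_sigma_finite "\<lambda>_::'a. lborel::real measure" ..
  let ?P = "Pi\<^sub>M (Basis::'a set) (\<lambda>_. lborel::real measure)"
  \<comment> \<open>By \<open>lborel_eq\<close>, Lebesgue measure on \<open>'a\<close> is the image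
    under \<open>?T\<close> of the product of one-dimensional Lebesgue measures; pulled back along
    \<open>?T\<close> the integrand factors.\<close>
  let ?T = "\<lambda>y::'a \<Rightarrow> real. \<Sum>b\<in>Basis. y b *\<^sub>R b"
  let ?F = "\<lambda>x::'a. \<Prod>b\<in>Basis. f b (x \<bullet> b)"
  have i: "\<And>b. b \<in> Basis \<Longrightarrow> integrable lborel (f b)"
    and e: "\<And>b. b \<in> Basis \<Longrightarrow> integral\<^sup>L lborel (f b) = I b"
    using f by (auto simp: has_bochner_integral_iff)
  have [measurable]: "\<And>b. b \<in> Basis \<Longrightarrow> f b \<in> borel_measurable borel"
    using i by (auto dest: borel_measurable_integrable)
  have FT: "?F (?T y) = (\<Prod>b\<in>Basis. f b (y b))" for y
    by (intro prod.cong) (auto simp: inner_sum_left_Basis)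
  have T: "?T \<in> ?P \<rightarrow>\<^sub>M borel" by measurable
  have m: "?F \<in> borel_measurable borel" by measurable
  have "integrable ?P (\<lambda>y. ?F (?T y))"
    unfolding FT by (intro product_integrable_prod i) auto
  then have 1: "integrable (distr ?P borel ?T) ?F"
    using T m by (subst integrable_distr_eq) auto
  have "integral\<^sup>L (distr ?P borel ?T) ?F = integral\<^sup>L ?P (\<lambda>y. ?F (?T y))"
    using T m by (subst integral_distr) auto
  also have "\<dots> = (\<Prod>b\<in>Basis. I b)"
    unfolding FT by (subst product_integral_prod) (auto simp: i e)
  finally show ?thesis
    using 1 unfolding has_bochner_integral_iff lborel_eq[where 'a='a] by blast
qed

lemma lborel_integral_affine:
  fixes f :: "'a::euclidean_space \<Rightarrow> 'b::{banach,second_countable_topology}"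
  assumes [measurable]: "f \<in> borel_measurable borel" and r: "r \<noteq> 0"
  shows "integral\<^sup>L lborel f = \<bar>r\<bar> ^ DIM('a) *\<^sub>R (LINT z|lborel. f (t + r *\<^sub>R z))"
  by (subst lborel_affine[OF r, of t]) (simp add: integral_density integral_distr)

lemma lborel_integrable_translate:
  fixes f :: "'a::euclidean_space \<Rightarrow> 'b::{banach,second_countable_topology}"
  assumes f: "integrable lborel f"
  shows "integrable lborel (\<lambda>z. f (t + z))"
proof -
  have "integrable (distr lborel borel ((+) t)) f"
    using f by (simp add: lborel_distr_plus)
  then show ?thesis
    using f by (subst (asm) integrable_distr_eq) auto
qed

text \<open>On each half-line, either the exponential density or its reflection equals c exp(-c
  |y|), so their sum divided by c is an integrable majorant.\<close>

lemma integrable_exp_neg_abs: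
  fixes c :: real assumes c: "0 < c"
  shows "integrable lborel (\<lambda>y::real. exp (- c * \<bar>y\<bar>))"
proof -
  interpret prob_space "density lborel (exponential_density c)"
    using prob_space_exponential_density[OF c] .
  have "integrable (density lborel (exponential_density c)) (\<lambda>x. 1::real)" by simp
  then have 1: "integrable lborel (exponential_density c)"
    by (subst (asm) integrable_density) (auto simp: exponential_density_nonneg[OF c])
  have 2: "integrable lborel (\<lambda>y. exponential_density c (0 + (-1) * y))"
    using 1 by (rule lborel_integrable_real_affine) simp
  show ?thesis
  proof (rule Bochner_Integration.integrable_bound)
    show "integrable lborel (\<lambda>y. (exponential_density c y + exponential_density c (0 + (-1) * y)) / c)"
      using 1 2 by simp
  qed (use c in \<open>auto simp: exponential_density_def field_simps\<close>)
qed

text \<open>Each coordinate is at most the norm, so the sum of the n coordinate moduli is at most n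
  |x|; the rate 1/n therefore makes the product of one-dimensional exponentials a majorant.\<close>

lemma integrable_exp_neg_norm:
  "integrable lborel (\<lambda>x::'a::euclidean_space. exp (- norm x))"
proof -
  let ?n = "real DIM('a)"
  have "has_bochner_integral lborel (\<lambda>y. complex_of_real (exp (- (1/?n) * \<bar>y\<bar>)))
      (complex_of_real (LINT y|lborel. exp (- (1/?n) * \<bar>y\<bar>)))"
    by (intro has_bochner_integral_of_real has_bochner_integral_integrable integrable_exp_neg_abs) simp
  from has_bochner_integral_prod_Basis[where 'a='a, OF this]
  have "integrable lborel (\<lambda>x::'a. \<Prod>b\<in>Basis. complex_of_real (exp (- (1/?n) * \<bar>x \<bullet> b\<bar>)))"
    by (simp add: has_bochner_integral_iff)
  then show ?thesis
  proof (rule Bochner_Integration.integrable_bound)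
    have "exp (- norm x) \<le> (\<Prod>b\<in>Basis. exp (- (1/?n) * \<bar>x \<bullet> b\<bar>))" for x :: 'a
    proof -
      have "(\<Sum>b\<in>Basis. \<bar>x \<bullet> b\<bar>) \<le> (\<Sum>b\<in>(Basis::'a set). norm x)"
        by (intro sum_mono) (simp add: Basis_le_norm)
      then have "- norm x \<le> (\<Sum>b\<in>Basis. - (1/?n) * \<bar>x \<bullet> b\<bar>)"
        by (simp add: sum_negf sum_divide_distrib[symmetric] field_simps)
      then show ?thesis by (simp add: exp_sum[symmetric])
    qed
    then show "AE x::'a in lborel. norm (exp (- norm x)) \<le>
        norm (\<Prod>b\<in>Basis. complex_of_real (exp (- (1/?n) * \<bar>x \<bullet> b\<bar>)))"
      by (intro AE_I2) (simp add: prod_norm[symmetric])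
  qed simp
qed

section \<open>Gaussians\<close>

text \<open>Parametrised by the rate and left unnormalised: products add rates, and the Fourier
  transform sends rate c to rate 1/(4c), an involution used throughout.\<close>

definition gaussian :: "real \<Rightarrow> 'a::euclidean_space \<Rightarrow> real" where
  "gaussian c x = exp (- c * (norm x)\<^sup>2)"

lemma gaussian_pos [simp]: "0 < gaussian c x" and gaussian_nonneg [simp]: "0 \<le> gaussian c x"
  by (auto simp: gaussian_def)

lemma gaussian_minus [simp]: "gaussian c (- x) = gaussian c x"
  by (simp add: gaussian_def)

lemma gaussian_mult: "gaussian c x * gaussian d x = gaussian (c + d) x"
  by (simp add: gaussian_def exp_add[symmetric] algebra_simps)

lemma borel_measurable_gaussian [measurable]: "gaussian c \<in> borel_measurable borel"
  unfolding gaussian_def[abs_def] by measurable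

lemma borel_measurable_cis [measurable]: "cis \<in> borel_measurable borel"
  by (intro borel_measurable_continuous_onI continuous_intros)

text \<open>This is the characteristic function of the standard normal law after rescaling the
  variable by sqrt(2c), the frequency accordingly to -t / sqrt(2c), and removing the normalisation
  sqrt(2 pi).\<close>

lemma fourier_gaussian_real:
  fixes c t :: real assumes c: "0 < c"
  shows "has_bochner_integral lborel (\<lambda>y. complex_of_real (exp (- c * y\<^sup>2)) * cis (- (y * t)))
    (complex_of_real (sqrt (pi / c) * exp (- t\<^sup>2 / (4 * c))))"
proof -
  let ?k = "sqrt (2 * c)"
  let ?\<tau> = "- t / ?k"
  let ?f = "\<lambda>y. std_normal_density y *\<^sub>R cis (y * ?\<tau>)"
  have "(LINT y|std_normal_distribution. iexp (?\<tau> * y)) = exp (- (?\<tau>\<^sup>2) / 2)"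
    using fun_cong[OF char_std_normal_distribution, of ?\<tau>] unfolding char_def .
  then have e: "integral\<^sup>L lborel ?f = exp (- (?\<tau>\<^sup>2) / 2)"
    by (subst (asm) integral_density) (auto simp: cis_conv_exp mult_ac)
  have "integrable lborel std_normal_density" by simp
  then have "integrable lborel ?f"
    by (rule Bochner_Integration.integrable_bound) (auto simp: cis_conv_exp)
  with e have "has_bochner_integral lborel ?f (exp (- (?\<tau>\<^sup>2) / 2))"
    by (simp add: has_bochner_integral_iff)
  then have "has_bochner_integral lborel (\<lambda>y. ?f (0 + ?k * y)) (complex_of_real (exp (- (?\<tau>\<^sup>2) / 2)) /\<^sub>R \<bar>?k\<bar>)"
    using c by (subst (asm) lborel_has_bochner_integral_real_affine_iff[of ?k _ _ 0]) auto
  then have "has_bochner_integral lborel (\<lambda>y. complex_of_real (sqrt (2 * pi)) * ?f (0 + ?k * y))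
      (complex_of_real (sqrt (2 * pi)) * (complex_of_real (exp (- (?\<tau>\<^sup>2) / 2)) /\<^sub>R \<bar>?k\<bar>))"
    by (rule has_bochner_integral_mult_right)
  moreover have "complex_of_real (sqrt (2 * pi)) * ?f (0 + ?k * y) =
      complex_of_real (exp (- c * y\<^sup>2)) * cis (- (y * t))" for y
    using c by (simp add: std_normal_density_def scaleR_conv_of_real power_mult_distrib)
  moreover have "complex_of_real (sqrt (2 * pi)) * (complex_of_real (exp (- (?\<tau>\<^sup>2) / 2)) /\<^sub>R \<bar>?k\<bar>)
     = complex_of_real (sqrt (pi / c) * exp (- t\<^sup>2 / (4 * c)))"
    using c by (simp add: scaleR_conv_of_real power_divide real_sqrt_mult real_sqrt_divide field_simps)
  ultimately show ?thesis by simp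
qed

lemma fourier_gaussian:
  fixes \<xi> :: "'a::euclidean_space" assumes c: "0 < c"
  shows "has_bochner_integral lborel (\<lambda>x. complex_of_real (gaussian c x) * cis (- (x \<bullet> \<xi>)))
    (complex_of_real (sqrt (pi / c) ^ DIM('a) * gaussian (1 / (4 * c)) \<xi>))"
proof -
  have n: "(norm x)\<^sup>2 = (\<Sum>b\<in>Basis. (x \<bullet> b)\<^sup>2)" for x :: 'a
    unfolding power2_norm_eq_inner by (subst euclidean_inner) (simp add: power2_eq_square)
  have cis_sum: "cis (\<Sum>b\<in>A. g b) = (\<Prod>b\<in>A. cis (g b))" if "finite A" for A :: "'a set" and g
    using that by (induction A) (auto simp: cis_mult[symmetric])
  have eq: "complex_of_real (gaussian c x) * cis (- (x \<bullet> \<xi>)) =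
     (\<Prod>b\<in>Basis. complex_of_real (exp (- c * (x \<bullet> b)\<^sup>2)) * cis (- ((x \<bullet> b) * (\<xi> \<bullet> b))))" for x
  proof -
    have "cis (- (x \<bullet> \<xi>)) = (\<Prod>b\<in>Basis. cis (- ((x \<bullet> b) * (\<xi> \<bullet> b))))"
      by (subst euclidean_inner) (simp add: cis_sum[symmetric] sum_negf)
    moreover have "gaussian c x = (\<Prod>b\<in>Basis. exp (- c * (x \<bullet> b)\<^sup>2))"
      unfolding gaussian_def n by (simp add: exp_sum[symmetric] sum_distrib_left)
    ultimately show ?thesis by (simp add: prod.distrib)
  qed
  have eq2: "complex_of_real (sqrt (pi / c) ^ DIM('a) * gaussian (1 / (4 * c)) \<xi>) =
     (\<Prod>b\<in>Basis. complex_of_real (sqrt (pi / c) * exp (- (\<xi> \<bullet> b)\<^sup>2 / (4 * c))))"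
  proof -
    have "gaussian (1 / (4 * c)) \<xi> = (\<Prod>b\<in>Basis. exp (- (\<xi> \<bullet> b)\<^sup>2 / (4 * c)))"
      unfolding gaussian_def n by (simp add: exp_sum[symmetric] sum_negf sum_divide_distrib)
    then show ?thesis by (simp add: prod.distrib)
  qed
  show ?thesis
    unfolding eq eq2 by (rule has_bochner_integral_prod_Basis[OF fourier_gaussian_real[OF c]])
qed

lemma
  assumes c: "0 < c"
  shows integrable_gaussian: "integrable lborel (gaussian c :: 'a::euclidean_space \<Rightarrow> real)"
    and integral_gaussian: "integral\<^sup>L lborel (gaussian c :: 'a \<Rightarrow> real) = sqrt (pi / c) ^ DIM('a)"
proof -
  have "has_bochner_integral lborel (\<lambda>x::'a. complex_of_real (gaussian c x))
      (complex_of_real (sqrt (pi / c) ^ DIM('a)))"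
    using fourier_gaussian[OF c, of "0::'a"] by (simp add: gaussian_def)
  then have "has_bochner_integral lborel (\<lambda>x::'a. Re (complex_of_real (gaussian c x)))
      (Re (complex_of_real (sqrt (pi / c) ^ DIM('a))))"
    by (intro has_bochner_integral_Re)
  then show "integrable lborel (gaussian c :: 'a \<Rightarrow> real)"
     "integral\<^sup>L lborel (gaussian c :: 'a \<Rightarrow> real) = sqrt (pi / c) ^ DIM('a)"
    by (auto simp: has_bochner_integral_iff)
qed

lemma integrable_gaussian_shift:
  assumes c: "0 < c"
  shows "integrable lborel (\<lambda>x::'a::euclidean_space. gaussian c (x - \<eta>))"
  using lborel_integrable_translate[OF integrable_gaussian[OF c, where 'a='a], of "- \<eta>"]
  by (simp add: add.commute)

lemma fourier_L1_gaussian_modulated: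
  fixes \<xi> \<eta> :: "'a::euclidean_space" assumes c: "0 < c"
  shows "fourier_L1 (\<lambda>x. complex_of_real (gaussian c x) * cis (x \<bullet> \<eta>)) \<xi> =
    complex_of_real (sqrt (pi / c) ^ DIM('a) * gaussian (1 / (4 * c)) (\<xi> - \<eta>))"
proof -
  have "complex_of_real (gaussian c x) * cis (x \<bullet> \<eta>) * cis (- (x \<bullet> \<xi>)) =
      complex_of_real (gaussian c x) * cis (- (x \<bullet> (\<xi> - \<eta>)))" for x
    by (simp add: mult.assoc cis_mult inner_diff_right)
  then show ?thesis
    unfolding fourier_L1_def
    by (simp only: has_bochner_integral_integral_eq[OF fourier_gaussian[OF c, of "\<xi> - \<eta>"]])
qed

text \<open>The counterpart of \<open>fourier_L1_gaussian_modulated\<close>. Together the two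
  formulas give Fourier inversion for Gaussians, which is how the conjugated test function in the
  weak formulation is rewritten as a transform.\<close>

lemma fourier_L1_gaussian_shift:
  fixes x \<eta> :: "'a::euclidean_space" assumes c: "0 < c"
  shows "fourier_L1 (\<lambda>\<xi>. complex_of_real (gaussian c (\<xi> - \<eta>))) x =
    complex_of_real (sqrt (pi / c) ^ DIM('a) * gaussian (1 / (4 * c)) x) * cis (- (x \<bullet> \<eta>))"
proof -
  have "complex_of_real (gaussian c (\<eta> + 1 *\<^sub>R z - \<eta>)) * cis (- ((\<eta> + 1 *\<^sub>R z) \<bullet> x)) =
     cis (- (x \<bullet> \<eta>)) * (complex_of_real (gaussian c z) * cis (- (z \<bullet> x)))" for z
    by (simp add: inner_add_left cis_mult inner_commute[of \<eta> x])
  then have "(LINT z|lborel. complex_of_real (gaussian c (\<eta> + 1 *\<^sub>R z - \<eta>)) * cis (- ((\<eta> + 1 *\<^sub>R z) \<bullet> x))) =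
     cis (- (x \<bullet> \<eta>)) * (LINT z|lborel. complex_of_real (gaussian c z) * cis (- (z \<bullet> x)))"
    by (simp only: integral_mult_right_zero)
  moreover have m: "(\<lambda>\<xi>. complex_of_real (gaussian c (\<xi> - \<eta>)) * cis (- (\<xi> \<bullet> x))) \<in> borel_measurable borel"
    by measurable
  ultimately show ?thesis
    unfolding fourier_L1_def has_bochner_integral_integral_eq[OF fourier_gaussian[OF c, of x]]
    by (subst lborel_integral_affine[OF m, where r=1 and t=\<eta>]) (simp_all add: mult.commute)
qed

text \<open>Half of the exponent pays for the polynomial factor, by 1 + y <= exp y with y = (c/2)
  |x|^2.\<close>

lemma norm_square_gaussian_le:
  assumes c: "0 < c"
  shows "(1 + (norm x)\<^sup>2) * gaussian c x \<le> (1 + 2 / c) * gaussian (c / 2) x"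
proof -
  let ?y = "(c / 2) * (norm x)\<^sup>2"
  have "1 + ?y \<le> exp ?y" by (rule exp_ge_add_one_self)
  then have "(1 + (norm x)\<^sup>2) \<le> (1 + 2 / c) * exp ?y"
  proof -
    have y: "0 \<le> ?y" using c by simp
    have e: "exp ?y \<ge> 1" "exp ?y \<ge> ?y" using \<open>1 + ?y \<le> exp ?y\<close> y by linarith+
    have "(norm x)\<^sup>2 = (2 / c) * ?y" using c by simp
    also have "\<dots> \<le> (2 / c) * exp ?y" using e c by (intro mult_left_mono) auto
    finally have "(norm x)\<^sup>2 \<le> (2 / c) * exp ?y" .
    with e(1) show ?thesis unfolding distrib_right by linarith
  qed
  then have "(1 + (norm x)\<^sup>2) * gaussian c x \<le> ((1 + 2 / c) * exp ?y) * gaussian c x"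
    by (intro mult_right_mono) auto
  also have "\<dots> = (1 + 2 / c) * gaussian (c / 2) x"
    by (simp add: gaussian_def exp_add[symmetric] algebra_simps)
  finally show ?thesis .
qed

text \<open>A Peetre-type inequality: growth in \<eta> + z is traded for growth in z at the price of
  a constant depending only on \<eta>, so that a Gaussian in z can absorb it.\<close>

lemma norm_square_shift_le:
  fixes \<eta> :: "'a::real_normed_vector"
  shows "1 + (norm (\<eta> + z))\<^sup>2 \<le> (1 + 2 * (norm \<eta>)\<^sup>2) * (2 * (1 + (norm z)\<^sup>2))"
proof -
  have "(norm (\<eta> + z))\<^sup>2 \<le> (norm \<eta> + norm z)\<^sup>2"
    by (intro power_mono norm_triangle_ineq) auto
  also have "\<dots> \<le> 2 * (norm \<eta>)\<^sup>2 + 2 * (norm z)\<^sup>2"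
    using sum_squares_bound[of "norm \<eta>" "norm z"] by (simp add: power2_sum)
  finally have "1 + (norm (\<eta> + z))\<^sup>2 \<le> 1 + 2 * (norm \<eta>)\<^sup>2 + 2 * (norm z)\<^sup>2" by simp
  moreover have "0 \<le> (norm \<eta>)\<^sup>2 * (norm z)\<^sup>2" "0 \<le> (norm \<eta>)\<^sup>2" by simp_all
  moreover have "(1 + 2 * (norm \<eta>)\<^sup>2) * (2 * (1 + (norm z)\<^sup>2)) =
      2 + 2 * (norm z)\<^sup>2 + 4 * (norm \<eta>)\<^sup>2 + 4 * ((norm \<eta>)\<^sup>2 * (norm z)\<^sup>2)"
    by (simp add: algebra_simps)
  ultimately show ?thesis by linarith
qed

text \<open>With the scaling moved into the argument of \<open>h\<close> the Gaussian stays fixed,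
  and one majorant serves all n. The factor sqrt pi to the dimension is the mass of the unnormalised
  Gaussian.\<close>

lemma gaussian_approximate_identity:
  fixes h :: "'a::euclidean_space \<Rightarrow> complex"
  assumes [measurable]: "h \<in> borel_measurable borel" and cont: "isCont h \<eta>"
    and bound: "\<And>y. norm (h y) \<le> M * (1 + (norm y)\<^sup>2)"
  shows "(\<lambda>n. LINT z|lborel. h (\<eta> + (1 / real (Suc n)) *\<^sub>R z) * complex_of_real (gaussian 1 z))
    \<longlonglongrightarrow> h \<eta> * complex_of_real (sqrt pi ^ DIM('a))"
proof -
  let ?r = "\<lambda>n. 1 / real (Suc n)"
  have M: "0 \<le> M" using order_trans[OF norm_ge_zero bound[of 0]] by simp
  \<comment> \<open>The 6 is the 2 from \<open>norm_square_shift_le\<close> times 1 + 2/c at c = 1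
    from \<open>norm_square_gaussian_le\<close>.\<close>
  let ?K = "M * ((1 + 2 * (norm \<eta>)\<^sup>2) * 6)"
  have "(\<lambda>n. LINT z|lborel. h (\<eta> + ?r n *\<^sub>R z) * complex_of_real (gaussian 1 z))
     \<longlonglongrightarrow> (LINT z::'a|lborel. h \<eta> * complex_of_real (gaussian 1 z))"
  proof (rule integral_dominated_convergence)
    show "integrable lborel (\<lambda>z::'a. ?K * gaussian (1/2) z)"
      by (intro integrable_mult_right integrable_gaussian) simp
    show "AE z in lborel. (\<lambda>n. h (\<eta> + ?r n *\<^sub>R z) * complex_of_real (gaussian 1 z))
        \<longlonglongrightarrow> h \<eta> * complex_of_real (gaussian 1 z)"
    proof (intro AE_I2 tendsto_mult tendsto_const)
      fix z
      have "(\<lambda>n. \<eta> + ?r n *\<^sub>R z) \<longlonglongrightarrow> \<eta> + 0 *\<^sub>R z"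
        by (intro tendsto_intros LIMSEQ_Suc[OF lim_1_over_n])
      then show "(\<lambda>n. h (\<eta> + ?r n *\<^sub>R z)) \<longlonglongrightarrow> h \<eta>"
        by (intro isCont_tendsto_compose[OF cont]) simp
    qed
    show "AE z in lborel. norm (h (\<eta> + ?r n *\<^sub>R z) * complex_of_real (gaussian 1 z)) \<le> ?K * gaussian (1/2) z" for n
    proof (rule AE_I2)
      fix z :: 'a
      have "norm (?r n *\<^sub>R z) \<le> norm z"
        by (simp add: divide_le_eq mult_left_le) (simp add: distrib_left)
      then have *: "(norm (?r n *\<^sub>R z))\<^sup>2 \<le> (norm z)\<^sup>2" by (intro power_mono) auto
      have "norm (h (\<eta> + ?r n *\<^sub>R z)) \<le> M * (1 + (norm (\<eta> + ?r n *\<^sub>R z))\<^sup>2)" by (rule bound)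
      also have "\<dots> \<le> M * ((1 + 2 * (norm \<eta>)\<^sup>2) * (2 * (1 + (norm (?r n *\<^sub>R z))\<^sup>2)))"
        by (intro mult_left_mono norm_square_shift_le M)
      also have "\<dots> \<le> M * ((1 + 2 * (norm \<eta>)\<^sup>2) * (2 * (1 + (norm z)\<^sup>2)))"
        using * by (intro mult_left_mono M add_left_mono) auto
      finally have "norm (h (\<eta> + ?r n *\<^sub>R z)) * gaussian 1 z
          \<le> M * ((1 + 2 * (norm \<eta>)\<^sup>2) * (2 * (1 + (norm z)\<^sup>2))) * gaussian 1 z"
        by (intro mult_right_mono) auto
      also have "\<dots> = M * (1 + 2 * (norm \<eta>)\<^sup>2) * 2 * ((1 + (norm z)\<^sup>2) * gaussian 1 z)"
        by (simp only: mult_ac)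
      also have "\<dots> \<le> M * (1 + 2 * (norm \<eta>)\<^sup>2) * 2 * ((1 + 2 / 1) * gaussian (1 / 2) z)"
        using M by (intro mult_left_mono norm_square_gaussian_le) auto
      also have "\<dots> = ?K * gaussian (1/2) z" by simp
      finally show "norm (h (\<eta> + ?r n *\<^sub>R z) * complex_of_real (gaussian 1 z)) \<le> ?K * gaussian (1/2) z"
        by (simp add: norm_mult)
    qed
  qed measurable
  also have "(LINT z::'a|lborel. h \<eta> * complex_of_real (gaussian 1 z)) = h \<eta> * complex_of_real (sqrt pi ^ DIM('a))"
    by (simp add: integral_gaussian)
  finally show ?thesis .
qed

lemma integral_gaussian_rescale:
  fixes h :: "'a::euclidean_space \<Rightarrow> complex"
  assumes [measurable]: "h \<in> borel_measurable borel" and r: "0 < r"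
  shows "(LINT y|lborel. h y * complex_of_real (gaussian (1 / r\<^sup>2) (y - \<eta>))) =
    r ^ DIM('a) *\<^sub>R (LINT z|lborel. h (\<eta> + r *\<^sub>R z) * complex_of_real (gaussian 1 z))"
proof -
  have "gaussian (1 / r\<^sup>2) (\<eta> + r *\<^sub>R z - \<eta>) = gaussian 1 z" for z :: 'a
    using r by (simp add: gaussian_def power_mult_distrib)
  then show ?thesis
    using r by (subst lborel_integral_affine[where r=r and t=\<eta>]) (simp_all del: add_diff_cancel_left')
qed

section \<open>The Fourier transform of integrable functions\<close>

lemma integrable_fourier_integrand:
  fixes f :: "'a::euclidean_space \<Rightarrow> complex"
  assumes f: "integrable lborel f"
  shows "integrable lborel (\<lambda>x. f x * cis (- (x \<bullet> \<xi>)))"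
proof (rule Bochner_Integration.integrable_bound[OF f])
  show "(\<lambda>x. f x * cis (- (x \<bullet> \<xi>))) \<in> borel_measurable lborel"
    using borel_measurable_integrable[OF f] by measurable
qed (simp add: norm_mult)

lemma norm_fourier_L1_le:
  fixes f :: "'a::euclidean_space \<Rightarrow> complex"
  shows "norm (fourier_L1 f \<xi>) \<le> (LINT x|lborel. norm (f x))"
  unfolding fourier_L1_def
  using integral_norm_bound[of lborel "\<lambda>x. f x * cis (- (x \<bullet> \<xi>))"] by (simp add: norm_mult)

lemma isCont_fourier_L1:
  fixes f :: "'a::euclidean_space \<Rightarrow> complex"
  assumes f: "integrable lborel f"
  shows "isCont (fourier_L1 f) \<xi>"
  unfolding continuous_at_sequentially
proof (intro allI impI)
  fix X :: "nat \<Rightarrow> 'a" assume X: "X \<longlonglongrightarrow> \<xi>"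
  show "(fourier_L1 f \<circ> X) \<longlonglongrightarrow> fourier_L1 f \<xi>"
    unfolding fourier_L1_def o_def
  proof (rule integral_dominated_convergence)
    show "integrable lborel (\<lambda>x. norm (f x))" using f by simp
    show "AE x in lborel. (\<lambda>n. f x * cis (- (x \<bullet> X n))) \<longlonglongrightarrow> f x * cis (- (x \<bullet> \<xi>))"
      using X by (intro AE_I2 tendsto_intros)
  qed (use integrable_fourier_integrand[OF f] in \<open>auto simp: norm_mult\<close>)
qed

lemma borel_measurable_fourier_L1:
  fixes f :: "'a::euclidean_space \<Rightarrow> complex"
  assumes f: "integrable lborel f"
  shows "fourier_L1 f \<in> borel_measurable borel"
  by (intro borel_measurable_continuous_onI continuous_at_imp_continuous_on ballI isCont_fourier_L1 f)

text \<open>The multiplication formula: Fubini for a kernel symmetric in x and \<xi>, with |f(x)|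
  |g(\<xi>)| integrable on the product. It has the same shape as the duality defining
  \<open>fourier_L2\<close>, so the two can be chained.\<close>

lemma fourier_L1_duality:
  fixes f g :: "'a::euclidean_space \<Rightarrow> complex"
  assumes f: "integrable lborel f" and g: "integrable lborel g"
  shows "(LINT x|lborel. f x * fourier_L1 g x) = (LINT \<xi>|lborel. fourier_L1 f \<xi> * g \<xi>)"
proof -
  let ?H = "\<lambda>x \<xi>. f x * (g \<xi> * cis (- (\<xi> \<bullet> x)))"
  have [measurable]: "f \<in> borel_measurable borel" "g \<in> borel_measurable borel"
    using borel_measurable_integrable[OF f] borel_measurable_integrable[OF g] by simp_all
  have "integrable (lborel \<Otimes>\<^sub>M lborel) (\<lambda>(x, \<xi>). ?H x \<xi>)"
  proof (rule lborel_pair.Fubini_integrable)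
    show "integrable lborel (\<lambda>x. LINT y|lborel. norm (case (x, y) of (x, \<xi>) \<Rightarrow> ?H x \<xi>))"
      using f by (simp add: norm_mult)
    show "AE x in lborel. integrable lborel (\<lambda>y. case (x, y) of (x, \<xi>) \<Rightarrow> ?H x \<xi>)"
      using integrable_fourier_integrand[OF g] by simp
  qed measurable
  then have "(LINT \<xi>|lborel. LINT x|lborel. ?H x \<xi>) = (LINT x|lborel. LINT \<xi>|lborel. ?H x \<xi>)"
    by (rule lborel_pair.Fubini_integral)
  moreover have "(LINT x|lborel. ?H x \<xi>) = fourier_L1 f \<xi> * g \<xi>" for \<xi>
  proof -
    have "?H x \<xi> = f x * cis (- (x \<bullet> \<xi>)) * g \<xi>" for x
      by (simp add: inner_commute)
    then show ?thesis unfolding fourier_L1_def by (simp only: integral_mult_left_zero)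
  qed
  moreover have "(LINT \<xi>|lborel. ?H x \<xi>) = f x * fourier_L1 g x" for x
    by (simp only: fourier_L1_def integral_mult_right_zero)
  ultimately show ?thesis by (simp only:)
qed

text \<open>The character exp(-i t x.\<omega>) is expanded in t and integrated term by term. All
  partial sums of absolute values stay below exp(|\<omega>| |t| |x|) |f(x)|, which is why every
  exponential rate is assumed integrable.\<close>

lemma fourier_L1_power_series:
  fixes f :: "'a::euclidean_space \<Rightarrow> complex"
  assumes [measurable]: "f \<in> borel_measurable borel"
    and f: "\<And>r. integrable lborel (\<lambda>x. exp (r * norm x) * norm (f x))"
  shows "\<exists>a. \<forall>t. (\<lambda>k. a k * of_real t ^ k) sums fourier_L1 f (t *\<^sub>R \<omega>)"
\<comment> \<open>The witness stays schematic until the last \<open>show\<close>: its k-th value is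
  the moment of (-i x.\<omega>)^k / k! against \<open>f\<close>. Introduced before \<open>t\<close>,
  it cannot depend on it.\<close>
proof (intro exI allI)
  fix t :: real
  let ?F = "\<lambda>k x. f x * ((- (\<i> * of_real (x \<bullet> \<omega>))) ^ k / fact k) * of_real t ^ k"
  let ?r = "norm \<omega> * \<bar>t\<bar>"
  let ?E = "\<lambda>x. exp (?r * norm x) * norm (f x)"
  have exp_sums: "(\<lambda>k. norm (f x) * ((?r * norm x) ^ k / fact k)) sums ?E x" for x
    using sums_mult[OF exp_converges[of "?r * norm x"], of "norm (f x)"]
    by (simp add: divide_inverse mult_ac)
  have nF: "norm (?F k x) \<le> norm (f x) * ((?r * norm x) ^ k / fact k)" for k x
  proof -
    have "\<bar>x \<bullet> \<omega>\<bar> * \<bar>t\<bar> \<le> ?r * norm x"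
      using mult_right_mono[OF Cauchy_Schwarz_ineq2[of x \<omega>], of "\<bar>t\<bar>"] by (simp add: mult_ac)
    then have "(\<bar>x \<bullet> \<omega>\<bar> * \<bar>t\<bar>) ^ k / fact k \<le> (?r * norm x) ^ k / fact k"
      by (intro divide_right_mono power_mono) auto
    then have "norm (f x) * ((\<bar>x \<bullet> \<omega>\<bar> * \<bar>t\<bar>) ^ k / fact k) \<le> norm (f x) * ((?r * norm x) ^ k / fact k)"
      by (intro mult_left_mono) auto
    then show ?thesis
      by (simp add: norm_mult norm_divide norm_power power_mult_distrib mult_ac)
  qed
  have sF: "(\<Sum>k<n. norm (?F k x)) \<le> ?E x" for n x
  proof -
    have "(\<Sum>k<n. norm (?F k x)) \<le> (\<Sum>k<n. norm (f x) * ((?r * norm x) ^ k / fact k))"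
      by (intro sum_mono nF)
    also have "\<dots> \<le> (\<Sum>k. norm (f x) * ((?r * norm x) ^ k / fact k))"
      by (intro sum_le_suminf sums_summable[OF exp_sums]) auto
    also have "\<dots> = ?E x" by (rule sums_unique[OF exp_sums, symmetric])
    finally show ?thesis .
  qed
  have iF: "integrable lborel (?F k)" for k
  proof (rule Bochner_Integration.integrable_bound[OF f[of ?r]])
    have "norm (?F k x) \<le> (\<Sum>k<Suc k. norm (?F k x))" for x
      by (rule member_le_sum) auto
    then have "norm (?F k x) \<le> ?E x" for x
      using sF order_trans by blast
    then show "AE x in lborel. norm (?F k x) \<le> norm (?E x)"
      by (intro AE_I2) (metis abs_ge_self order_trans real_norm_def)
  qed measurable
  have "(\<lambda>k. integral\<^sup>L lborel (?F k)) sums (LINT x|lborel. (\<Sum>k. ?F k x))"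
  proof (rule sums_integral)
    show "AE x in lborel. summable (\<lambda>k. norm (?F k x))"
      by (intro AE_I2 summableI_nonneg_bounded[OF _ sF]) auto
    show "summable (\<lambda>k. LINT x|lborel. norm (?F k x))"
    proof (rule summableI_nonneg_bounded)
      fix n
      have "(\<Sum>k<n. LINT x|lborel. norm (?F k x)) = (LINT x|lborel. (\<Sum>k<n. norm (?F k x)))"
        by (intro Bochner_Integration.integral_sum[symmetric] integrable_norm iF)
      also have "\<dots> \<le> integral\<^sup>L lborel ?E"
        by (intro integral_mono Bochner_Integration.integrable_sum integrable_norm iF f sF)
      finally show "(\<Sum>k<n. LINT x|lborel. norm (?F k x)) \<le> integral\<^sup>L lborel ?E" .
    qed simp
  qed (rule iF)
  moreover have "(\<Sum>k. ?F k x) = f x * cis (- (x \<bullet> (t *\<^sub>R \<omega>)))" for x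
  proof -
    have "(\<lambda>k. f x * ((- (\<i> * of_real (x \<bullet> \<omega>) * of_real t)) ^ k /\<^sub>R fact k)) sums
        (f x * exp (- (\<i> * of_real (x \<bullet> \<omega>) * of_real t)))"
      by (intro sums_mult exp_converges)
    moreover have "f x * ((- (\<i> * of_real (x \<bullet> \<omega>) * of_real t)) ^ k /\<^sub>R fact k) = ?F k x" for k
      by (simp add: scaleR_conv_of_real divide_inverse power_mult_distrib[symmetric])
    moreover have "exp (- (\<i> * of_real (x \<bullet> \<omega>) * of_real t)) = cis (- (x \<bullet> (t *\<^sub>R \<omega>)))"
      by (simp add: cis_conv_exp mult_ac)
    ultimately show ?thesis by (simp add: sums_iff)
  qed
  moreover have "integral\<^sup>L lborel (?F k) =
      (LINT x|lborel. f x * ((- (\<i> * of_real (x \<bullet> \<omega>))) ^ k / fact k)) * of_real t ^ k" for k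
    by simp
  ultimately show "(\<lambda>k. (LINT x|lborel. f x * ((- (\<i> * of_real (x \<bullet> \<omega>))) ^ k / fact k)) * of_real t ^ k)
      sums fourier_L1 f (t *\<^sub>R \<omega>)"
    by (simp only: fourier_L1_def)
qed

text \<open>Here k is the order of vanishing at 0; dividing by t^k leaves a power series, continuous
  at 0, with constant term \<open>a k\<close>.\<close>

lemma power_series_lowest_order:
  fixes a :: "nat \<Rightarrow> complex"
  assumes sums: "\<And>t. (\<lambda>k. a k * of_real t ^ k) sums A t" and nz: "\<exists>k. a k \<noteq> 0"
  obtains k where "a k \<noteq> 0" "((\<lambda>t. A t / of_real t ^ k) \<longlongrightarrow> a k) (at (0::real))"
proof -
  define k where "k = (LEAST k. a k \<noteq> 0)"
  have k: "a k \<noteq> 0" unfolding k_def using nz by (rule LeastI_ex)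
  have z: "a j = 0" if "j < k" for j using not_less_Least that unfolding k_def by blast
  \<comment> \<open>Convergence is given at real points only; the real point |z| + 1 has larger
    modulus than z, which yields the complex convergence that \<open>powser_limit_0\<close> asks
    for.\<close>
  have ser: "summable (\<lambda>j. a j * z ^ j)" for z :: complex
  proof (rule powser_inside)
    show "summable (\<lambda>n. a n * (of_real (norm z + 1)) ^ n)" using sums by (rule sums_summable)
    show "norm z < norm (of_real (norm z + 1) :: complex)" unfolding norm_of_real by simp
  qed
  have ser': "summable (\<lambda>j. a (j + k) * z ^ j)" for z :: complex
  proof (cases "z = 0")
    case False
    from ser[of z] have "summable (\<lambda>j. a (j + k) * z ^ (j + k))"
      by (subst summable_iff_shift)
    then have "summable (\<lambda>j. a (j + k) * z ^ (j + k) / z ^ k)" by (rule summable_divide)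
    with False show ?thesis by (simp add: power_add)
  qed simp
  have "((\<lambda>z. \<Sum>j. a (j + k) * z ^ j) \<longlongrightarrow> a (0 + k)) (at (0::complex))"
    by (rule powser_limit_0[where s=1]) (use ser' in \<open>auto intro: summable_sums\<close>)
  moreover have "filterlim complex_of_real (at 0) (at 0)"
    unfolding filterlim_at by (auto intro!: tendsto_eq_intros simp: eventually_at_filter)
  ultimately have "((\<lambda>t. \<Sum>j. a (j + k) * of_real t ^ j) \<longlongrightarrow> a k) (at (0::real))"
    by (auto dest: filterlim_compose)
  moreover have eq: "(\<Sum>j. a (j + k) * of_real t ^ j) = A t / of_real t ^ k" if "t \<noteq> 0" for t
  proof -
    have "(\<lambda>j. a j * complex_of_real t ^ j) sums A t" by (rule sums)
    then have "(\<lambda>j. a (j + k) * complex_of_real t ^ (j + k)) sums (A t - (\<Sum>j<k. a j * of_real t ^ j))"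
      by (subst sums_iff_shift') simp
    then have "(\<lambda>j. a (j + k) * complex_of_real t ^ (j + k)) sums A t"
      using z by simp
    from sums_divide[OF this, of "of_real t ^ k"] show ?thesis
      using that by (simp add: power_add sums_iff)
  qed
  moreover have "\<forall>\<^sub>F t in at 0. (\<Sum>j. a (j + k) * of_real t ^ j) = A t / of_real t ^ k"
    using eq by (auto simp: eventually_at_filter)
  ultimately have "((\<lambda>t. A t / of_real t ^ k) \<longlongrightarrow> a k) (at (0::real))"
    by (blast intro: Lim_transform_eventually)
  with k show ?thesis by (rule that)
qed

text \<open>Comparing the lowest-order terms \<open>a\<^sub>k t\<^sup>k\<close> and \<open>b\<^sub>m t\<^sup>m\<close> as \<open>t\<close> decreases to 0 forces \<open>2s + k = m\<close>, hence \<open>s = 1/2\<close>;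
  then the signs for \<open>t > 0\<close> and \<open>t < 0\<close> contradict each other.\<close>

lemma fractional_power_times_power_series_zero:
  fixes a b :: "nat \<Rightarrow> complex" and s :: real
  assumes s: "0 < s" "s < 1"
    and A: "\<And>t. (\<lambda>k. a k * of_real t ^ k) sums A t"
    and B: "\<And>t. (\<lambda>k. b k * of_real t ^ k) sums B t"
    and eq: "\<And>t::real. of_real (\<bar>t\<bar> powr (2 * s)) * A t + B t = 0"
  shows "A t = 0"
proof -
  have "a k = 0" for k
  proof (rule ccontr)
    assume "a k \<noteq> 0"
    then obtain k where ak: "a k \<noteq> 0" and
      limA: "((\<lambda>t. A t / of_real t ^ k) \<longlongrightarrow> a k) (at (0::real))"
      using power_series_lowest_order[OF A] by blast
    \<comment> \<open>Without a nonzero coefficient of B, A would vanish off 0, against its nonzero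
      leading coefficient.\<close>
    have "\<exists>m. b m \<noteq> 0"
    proof (rule ccontr)
      assume "\<nexists>m. b m \<noteq> 0"
      then have "B t = 0" for t using B[of t] by (simp add: sums_iff)
      then have "A t = 0" if "t \<noteq> 0" for t using eq[of t] that by simp
      then have "((\<lambda>t. A t / of_real t ^ k) \<longlongrightarrow> 0) (at (0::real))"
        by (intro tendsto_eventually) (auto simp: eventually_at_filter)
      with limA have "a k = 0" by (intro tendsto_unique[of "at (0::real)"]) auto
      with ak show False by simp
    qed
    then obtain m where bm: "b m \<noteq> 0" and
      limB: "((\<lambda>t. B t / of_real t ^ m) \<longlongrightarrow> b m) (at (0::real))"
      using power_series_lowest_order[OF B] by blast
    let ?e = "2 * s + real k - real m"
    have limR: "((\<lambda>t. A t / of_real t ^ k) \<longlongrightarrow> a k) (at_right (0::real))"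
       "((\<lambda>t. B t / of_real t ^ m) \<longlongrightarrow> b m) (at_right (0::real))"
      using limA limB by (auto intro: filterlim_mono[OF _ order_refl at_le])
    have limL: "((\<lambda>t. A t / of_real t ^ k) \<longlongrightarrow> a k) (at_left (0::real))"
       "((\<lambda>t. B t / of_real t ^ m) \<longlongrightarrow> b m) (at_left (0::real))"
      using limA limB by (auto intro: filterlim_mono[OF _ order_refl at_le])
    have nA: "((\<lambda>t. norm (A t / of_real t ^ k)) \<longlongrightarrow> norm (a k)) (at_right (0::real))"
      and nB: "((\<lambda>t. norm (B t / of_real t ^ m)) \<longlongrightarrow> norm (b m)) (at_right (0::real))"
      using limR by (auto intro: tendsto_norm)
    \<comment> \<open>Taking norms removes the complex phases, so that the orders k and m can be
      compared through a real power of t alone.\<close>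
    have R: "\<forall>\<^sub>F t in at_right 0. t powr ?e * norm (A t / of_real t ^ k) = norm (B t / of_real t ^ m)"
      unfolding eventually_at_filter
    proof (intro always_eventually allI impI)
      fix t :: real assume "t \<noteq> 0" "t \<in> {0<..}"
      then have t: "0 < t" by simp
      have "norm (B t) = t powr (2 * s) * norm (A t)"
        using eq[of t] t by (simp add: eq_neg_iff_add_eq_0[symmetric] add.commute norm_mult)
      moreover have "t powr ?e = t powr (2 * s) * t ^ k / t ^ m"
        using t by (simp add: powr_add powr_diff powr_realpow)
      ultimately show "t powr ?e * norm (A t / of_real t ^ k) = norm (B t / of_real t ^ m)"
        using t by (simp add: norm_divide norm_power)
    qed
    have "((\<lambda>t. norm (B t / of_real t ^ m) / norm (A t / of_real t ^ k)) \<longlongrightarrow> norm (b m) / norm (a k)) (at_right (0::real))"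
      using ak by (intro tendsto_divide nA nB) auto
    moreover have "\<forall>\<^sub>F t in at_right (0::real). norm (A t / of_real t ^ k) \<noteq> 0"
      using nA ak by (intro tendsto_imp_eventually_ne) auto
    with R have "\<forall>\<^sub>F t in at_right 0. norm (B t / of_real t ^ m) / norm (A t / of_real t ^ k) = t powr ?e"
      by eventually_elim (auto simp: field_simps)
    ultimately have lim: "((\<lambda>t. t powr ?e) \<longlongrightarrow> norm (b m) / norm (a k)) (at_right (0::real))"
      by (rule Lim_transform_eventually)
    have pos: "0 < norm (b m) / norm (a k)" using ak bm by simp
    \<comment> \<open>The power of t has a finite positive limit at 0 from the right, whereas a
      positive exponent gives 0 and a negative one infinity.\<close>
    have e0: "?e = 0"
    proof (rule ccontr)
      assume "?e \<noteq> 0"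
      then consider "?e > 0" | "?e < 0" by linarith
      then show False
      proof cases
        case 1
        then have "((\<lambda>t. t powr ?e) \<longlongrightarrow> 0) (at_right (0::real))" by real_asymp
        with lim have "norm (b m) / norm (a k) = 0" by (intro tendsto_unique[of "at_right (0::real)"]) auto
        with pos show False by simp
      next
        case 2
        then have "filterlim (\<lambda>t. t powr ?e) at_top (at_right (0::real))" by real_asymp
        with lim show False by (auto dest: not_tendsto_and_filterlim_at_infinity[rotated] simp: filterlim_at_top_imp_at_infinity)
      qed
    qed
    \<comment> \<open>From m = k + 2s and 0 < 2s < 2, the integer m lies strictly between k and k +
      2.\<close>
    with s have "real m < real k + 2" "real k < real m" by linarith+
    then have m: "m = Suc k" by linarith
    with e0 have s2: "2 * s = 1" by simp
    have eq1: "of_real \<bar>t\<bar> * A t + B t = 0" for t using eq[of t] unfolding s2 by simp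
    have "((\<lambda>t. A t / of_real t ^ k + B t / of_real t ^ m) \<longlongrightarrow> a k + b m) (at_right (0::real))"
      by (intro tendsto_add limR)
    moreover have "((\<lambda>t. A t / of_real t ^ k + B t / of_real t ^ m) \<longlongrightarrow> 0) (at_right (0::real))"
    proof (intro tendsto_eventually)
      have "A t / of_real t ^ k + B t / of_real t ^ m = 0" if "0 < t" for t
        using eq1[of t] that by (simp add: m field_simps)
      then show "\<forall>\<^sub>F t in at_right 0. A t / of_real t ^ k + B t / of_real t ^ m = 0"
        by (auto simp: eventually_at_filter)
    qed
    ultimately have 1: "a k + b m = 0" by (intro tendsto_unique[of "at_right (0::real)"]) auto
    have "((\<lambda>t. A t / of_real t ^ k - B t / of_real t ^ m) \<longlongrightarrow> a k - b m) (at_left (0::real))"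
      by (intro tendsto_diff limL)
    moreover have "((\<lambda>t. A t / of_real t ^ k - B t / of_real t ^ m) \<longlongrightarrow> 0) (at_left (0::real))"
    proof (intro tendsto_eventually)
      have "A t / of_real t ^ k - B t / of_real t ^ m = 0" if "t < 0" for t
        using eq1[of t] that by (simp add: m field_simps)
      then show "\<forall>\<^sub>F t in at_left 0. A t / of_real t ^ k - B t / of_real t ^ m = 0"
        by (auto simp: eventually_at_filter)
    qed
    ultimately have 2: "a k - b m = 0" by (intro tendsto_unique[of "at_left (0::real)"]) auto
    from 1 2 ak show False by simp
  qed
  then show ?thesis using A[of t] by (simp add: sums_iff)
qed

section \<open>Decay and uniqueness\<close>

text \<open>The function is split as p w, where w^2 is the given integrable density, and p w <= p^2
  + w^2. Since \<alpha> > 1, the power |x|^\<alpha> outgrows every multiple of |x|, which bounds p^2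
  by a constant times exp(-|x|).\<close>

lemma superexponential_decay_integrable:
  fixes u :: "'a::euclidean_space \<Rightarrow> complex"
  assumes [measurable]: "u \<in> borel_measurable borel" and \<alpha>: "1 < \<alpha>"
    and int: "integrable lborel (\<lambda>x. exp (norm x powr \<alpha>) * (norm (u x))\<^sup>2)"
  shows "integrable lborel (\<lambda>x. exp (r * norm x) * norm (u x))"
proof -
  \<comment> \<open>Squaring p doubles the rate r; the extra 1 leaves the factor exp(-|x|). Beyond
    \<open>?R\<close> one has n^(\<alpha> - 1) >= \<open>?b\<close>, hence n^\<alpha> >=
    \<open>?b\<close> n.\<close>
  let ?b = "2 * \<bar>r\<bar> + 1"
  let ?R = "?b powr (1 / (\<alpha> - 1))"
  have R: "?b * n - n powr \<alpha> \<le> ?b * ?R" if "0 \<le> n" for n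
  proof (cases "n \<le> ?R")
    case True
    then have "?b * n \<le> ?b * ?R" by (intro mult_left_mono) auto
    then show ?thesis using powr_ge_zero[of n \<alpha>] by linarith
  next
    case False
    have "0 < ?R" by simp
    with False have n: "0 < n" by linarith
    have "?b = ?R powr (\<alpha> - 1)" using \<alpha> by (simp add: powr_powr)
    also have "\<dots> \<le> n powr (\<alpha> - 1)" using False \<alpha> by (intro powr_mono2) auto
    finally have "?b * n \<le> n powr (\<alpha> - 1) * n" using n by (intro mult_right_mono) auto
    also have "\<dots> = n powr \<alpha>" using n by (simp add: powr_diff)
    finally have "?b * n \<le> n powr \<alpha>" .
    moreover have "0 \<le> ?b * ?R" by simp
    ultimately show ?thesis by linarith
  qed
  let ?G = "\<lambda>x. exp (?b * ?R) * exp (- norm x) + exp (norm x powr \<alpha>) * (norm (u x))\<^sup>2"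
  have le: "exp (r * norm x) * norm (u x) \<le> ?G x" for x
  proof -
    let ?n = "norm x"
    let ?p = "exp (r * ?n - ?n powr \<alpha> / 2)" and ?w = "exp (?n powr \<alpha> / 2) * norm (u x)"
    have "exp (r * ?n) * norm (u x) = ?p * ?w"
      by (simp add: exp_diff)
    also have "\<dots> \<le> ?p\<^sup>2 + ?w\<^sup>2"
    proof -
      have "0 \<le> ?p * ?w" by simp
      with sum_squares_bound[of ?p ?w] show ?thesis by linarith
    qed
    also have "?w\<^sup>2 = exp (?n powr \<alpha>) * (norm (u x))\<^sup>2"
      by (simp add: power_mult_distrib exp_double[symmetric])
    also have "?p\<^sup>2 \<le> exp (?b * ?R) * exp (- ?n)"
    proof -
      have "r * ?n \<le> \<bar>r\<bar> * ?n" by (intro mult_right_mono) auto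
      with R[of ?n] have "2 * (r * ?n - ?n powr \<alpha> / 2) \<le> ?b * ?R - ?n"
        by (simp add: algebra_simps)
      then show ?thesis by (simp add: exp_double[symmetric] exp_add[symmetric])
    qed
    finally show ?thesis by simp
  qed
  show ?thesis
  proof (rule Bochner_Integration.integrable_bound)
    show "integrable lborel ?G"
      by (intro Bochner_Integration.integrable_add integrable_mult_right integrable_exp_neg_norm int)
    show "AE x in lborel. norm (exp (r * norm x) * norm (u x)) \<le> norm (?G x)"
    proof (rule AE_I2)
      fix x
      have "norm (exp (r * norm x) * norm (u x)) = exp (r * norm x) * norm (u x)" by simp
      also have "\<dots> \<le> ?G x" by (rule le)
      also have "\<dots> \<le> norm (?G x)" by simp
      finally show "norm (exp (r * norm x) * norm (u x)) \<le> norm (?G x)" .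
    qed
  qed measurable
qed

text \<open>Every translated Gaussian is a multiple of a Fourier transform, so \<open>f\<close>
  integrates to 0 against it; by Fubini the same holds for \<open>F\<close> smoothed by Gaussians.
  These smoothings are uniformly bounded and converge pointwise to \<open>F\<close>.\<close>

lemma integral_bounded_continuous_eq_0:
  fixes f F :: "'a::euclidean_space \<Rightarrow> complex"
  assumes f: "integrable lborel f" and zero: "\<And>\<xi>. fourier_L1 f \<xi> = 0"
    and F: "continuous_on UNIV F" and M: "\<And>x. norm (F x) \<le> M"
  shows "(LINT x|lborel. f x * F x) = 0"
proof -
  have [measurable]: "f \<in> borel_measurable borel" "F \<in> borel_measurable borel"
    using borel_measurable_integrable[OF f] borel_measurable_continuous_onI[OF F] by simp_all
  have M0: "0 \<le> M" using M[of 0] norm_ge_zero order_trans by blast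
  have conv: "(LINT y|lborel. f y * complex_of_real (gaussian c (y - \<eta>))) = 0" if c: "0 < c" for c \<eta>
  proof -
    \<comment> \<open>Rate 1/(4c) is the one whose transform has rate c; modulation by \<eta> then
      produces the translation.\<close>
    let ?d = "1 / (4 * c)"
    let ?g = "\<lambda>x. complex_of_real (gaussian ?d x) * cis (x \<bullet> \<eta>)"
    have d: "0 < ?d" using c by simp
    have "integrable lborel ?g"
      by (rule Bochner_Integration.integrable_bound[OF integrable_gaussian[OF d]]) (auto simp: norm_mult)
    from fourier_L1_duality[OF f this] zero
    have "(LINT y|lborel. f y * fourier_L1 ?g y) = 0" by simp
    then have "(LINT y|lborel. complex_of_real (sqrt (pi / ?d) ^ DIM('a)) * (f y * complex_of_real (gaussian c (y - \<eta>)))) = 0"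
      unfolding fourier_L1_gaussian_modulated[OF d] using c by (simp add: mult_ac)
    then show ?thesis using c by (simp only: integral_mult_right_zero) simp
  qed
  let ?G = "\<lambda>n y. LINT z|lborel. F (y + (1 / real (Suc n)) *\<^sub>R z) * complex_of_real (gaussian 1 z)"
  have zeroG: "(LINT y|lborel. f y * ?G n y) = 0" for n
  proof -
    let ?r = "1 / real (Suc n)"
    let ?c = "1 / ?r\<^sup>2"
    let ?H = "\<lambda>y \<eta>. f y * (F \<eta> * complex_of_real (gaussian ?c (\<eta> - y)))"
    have c: "0 < ?c" by simp
    have iF: "integrable lborel (\<lambda>\<eta>. F \<eta> * complex_of_real (gaussian ?c (\<eta> - y)))" for y
      by (rule Bochner_Integration.integrable_bound[OF integrable_mult_right[OF integrable_gaussian_shift[OF c, of y], of M]])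
        (use M M0 in \<open>auto simp: norm_mult intro!: mult_right_mono\<close>)
    have "integrable (lborel \<Otimes>\<^sub>M lborel) (\<lambda>(y, \<eta>). ?H y \<eta>)"
    proof (rule lborel_pair.Fubini_integrable)
      let ?I = "\<lambda>y. LINT \<eta>|lborel. norm (F \<eta>) * gaussian ?c (\<eta> - y)"
      define B where "B = M * sqrt (pi / ?c) ^ DIM('a)"
      have I: "\<bar>?I y\<bar> \<le> B" for y
      proof -
        have "?I y \<le> (LINT \<eta>|lborel. M * gaussian ?c (\<eta> - y))"
          using iF[of y] M integrable_gaussian_shift[OF c]
          by (intro integral_mono) (auto simp: norm_mult dest: integrable_norm intro!: mult_right_mono)
        also have "\<dots> = M * (LINT z|lborel. gaussian ?c (z::'a))"
          using lborel_integral_affine[of "\<lambda>\<eta>. gaussian ?c (\<eta> - y)" 1 y] by simp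
        finally have "?I y \<le> B" unfolding B_def integral_gaussian[OF c] .
        moreover have "0 \<le> ?I y" by (intro integral_nonneg_AE) auto
        ultimately show ?thesis by simp
      qed
      have "integrable lborel (\<lambda>y. norm (f y) * ?I y)"
      proof (rule Bochner_Integration.integrable_bound)
        show "integrable lborel (\<lambda>y. norm (f y) * B)"
          using f by (intro integrable_mult_left integrable_norm)
        show "AE y in lborel. norm (norm (f y) * ?I y) \<le> norm (norm (f y) * B)"
        proof (rule AE_I2)
          fix y
          show "norm (norm (f y) * ?I y) \<le> norm (norm (f y) * B)"
            unfolding real_norm_def abs_mult
            by (intro mult_left_mono order_trans[OF I abs_ge_self]) auto
        qed
      qed measurable
      then show "integrable lborel (\<lambda>y. LINT \<eta>|lborel. norm (case (y, \<eta>) of (y, \<eta>) \<Rightarrow> ?H y \<eta>))"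
        by (simp add: norm_mult)
      show "AE y in lborel. integrable lborel (\<lambda>\<eta>. case (y, \<eta>) of (y, \<eta>) \<Rightarrow> ?H y \<eta>)"
        using iF by simp
    qed measurable
    then have swap: "(LINT \<eta>|lborel. LINT y|lborel. ?H y \<eta>) = (LINT y|lborel. LINT \<eta>|lborel. ?H y \<eta>)"
      by (rule lborel_pair.Fubini_integral)
    \<comment> \<open>The Gaussian is even, so as a function of y it is again a translate, centred
      at \<eta>, and \<open>conv\<close> applies.\<close>
    have y0: "(LINT y|lborel. ?H y \<eta>) = 0" for \<eta>
    proof -
      have "?H y \<eta> = F \<eta> * (f y * complex_of_real (gaussian ?c (y - \<eta>)))" for y
        using gaussian_minus[of ?c "y - \<eta>"] by (simp add: mult_ac del: gaussian_minus)
      then show ?thesis by (simp only: integral_mult_right_zero conv[OF c] mult_zero_right)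
    qed
    have "(LINT \<eta>|lborel. ?H y \<eta>) = complex_of_real (?r ^ DIM('a)) * (f y * ?G n y)" for y
    proof -
      have "(LINT \<eta>|lborel. ?H y \<eta>) = f y * (LINT \<eta>|lborel. F \<eta> * complex_of_real (gaussian ?c (\<eta> - y)))"
        by (simp only: integral_mult_right_zero)
      also have "\<dots> = f y * (?r ^ DIM('a) *\<^sub>R ?G n y)"
        by (subst integral_gaussian_rescale) auto
      finally show ?thesis by (simp add: scaleR_conv_of_real)
    qed
    then have "(LINT y|lborel. complex_of_real (?r ^ DIM('a)) * (f y * ?G n y)) = (LINT \<eta>|lborel. LINT y|lborel. ?H y \<eta>)"
      by (simp only: swap)
    also have "\<dots> = 0" unfolding y0 by simp
    finally have "(LINT y|lborel. complex_of_real (?r ^ DIM('a)) * (f y * ?G n y)) = 0" .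
    then show ?thesis by (simp only: integral_mult_right_zero) (simp del: of_nat_Suc)
  qed
  have "(\<lambda>n. LINT y|lborel. f y * ?G n y) \<longlonglongrightarrow> (LINT y|lborel. f y * (F y * complex_of_real (sqrt pi ^ DIM('a))))"
  proof (rule integral_dominated_convergence)
    show "integrable lborel (\<lambda>y. norm (f y) * (M * sqrt pi ^ DIM('a)))"
      using f by (intro integrable_mult_left integrable_norm)
    show "AE y in lborel. (\<lambda>n. f y * ?G n y) \<longlonglongrightarrow> f y * (F y * complex_of_real (sqrt pi ^ DIM('a)))"
    proof (intro AE_I2 tendsto_mult[OF tendsto_const] gaussian_approximate_identity)
      fix y :: 'a
      show "isCont F y" using F by (simp add: continuous_on_eq_continuous_at)
      show "norm (F x) \<le> M * (1 + (norm x)\<^sup>2)" for x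
        using M[of x] mult_left_mono[OF _ M0, of 1 "1 + (norm x)\<^sup>2"] by simp
    qed measurable
    show "AE y in lborel. norm (f y * ?G n y) \<le> norm (f y) * (M * sqrt pi ^ DIM('a))" for n
    proof (rule AE_I2)
      fix y
      have "norm (?G n y) \<le> (LINT z|lborel. norm (F (y + (1 / real (Suc n)) *\<^sub>R z) * complex_of_real (gaussian 1 z)))"
        by (rule integral_norm_bound)
      also have "\<dots> \<le> (LINT z::'a|lborel. M * gaussian 1 z)"
      proof (rule integral_mono)
        show i: "integrable lborel (\<lambda>z::'a. M * gaussian 1 z)"
          by (intro integrable_mult_right integrable_gaussian) simp
        show "integrable lborel (\<lambda>z. norm (F (y + (1 / real (Suc n)) *\<^sub>R z) * complex_of_real (gaussian 1 z)))"
          by (rule Bochner_Integration.integrable_bound[OF i])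
            (use M M0 in \<open>auto simp: norm_mult abs_mult intro!: mult_right_mono\<close>)
      qed (use M in \<open>auto simp: norm_mult intro!: mult_right_mono\<close>)
      also have "\<dots> = M * sqrt pi ^ DIM('a)" by (simp add: integral_gaussian)
      finally show "norm (f y * ?G n y) \<le> norm (f y) * (M * sqrt pi ^ DIM('a))"
        unfolding norm_mult by (intro mult_left_mono) auto
    qed
  qed measurable
  then have "(LINT y|lborel. f y * (F y * complex_of_real (sqrt pi ^ DIM('a)))) = 0"
    unfolding zeroG by (simp add: LIMSEQ_const_iff)
  then show ?thesis by (simp only: mult.assoc[symmetric] integral_mult_left_zero) simp
qed

text \<open>Continuous cut-offs converge to the indicator of a closed set, so \<open>f\<close> has
  integral 0 over closed sets. These form an intersection-stable generator, and a Dynkin argument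
  extends this to Borel sets.\<close>

lemma fourier_L1_eq_0_imp_AE_0:
  fixes f :: "'a::euclidean_space \<Rightarrow> complex"
  assumes f: "integrable lborel f" and zero: "\<And>\<xi>. fourier_L1 f \<xi> = 0"
  shows "AE x in lborel. f x = 0"
proof (rule sigma_finite_measure.density_zero[OF sigma_finite_lborel f])
  have [measurable]: "f \<in> borel_measurable borel"
    using borel_measurable_integrable[OF f] by simp
  have closed: "(LINT x:S|lborel. f x) = 0" if S: "closed S" for S
  \<comment> \<open>The empty set is treated apart because \<open>infdist x {} = 0\<close>, which
    would make the cut-off identically 1.\<close>
  proof (cases "S = {}")
    case False
    let ?F = "\<lambda>k x. complex_of_real (max 0 (1 - real k * infdist x S))"
    have z: "(LINT x|lborel. f x * ?F k x) = 0" for k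
      by (rule integral_bounded_continuous_eq_0[OF f zero, where M=1])
        (auto intro!: continuous_intros simp: infdist_nonneg)
    have "(\<lambda>k. LINT x|lborel. f x * ?F k x) \<longlonglongrightarrow> (LINT x|lborel. f x * indicator S x)"
    proof (rule integral_dominated_convergence)
      show "integrable lborel (\<lambda>x. norm (f x))" using f by simp
      show "AE x in lborel. (\<lambda>k. f x * ?F k x) \<longlonglongrightarrow> f x * indicator S x"
      proof (intro AE_I2 tendsto_mult tendsto_const)
        fix x
        show "(\<lambda>k. ?F k x) \<longlonglongrightarrow> indicator S x"
        proof (cases "x \<in> S")
          case False
          then have "0 < infdist x S"
            using S \<open>S \<noteq> {}\<close> infdist_pos_not_in_closed by blast
          then have "\<forall>\<^sub>F k in sequentially. 1 - real k * infdist x S \<le> 0" by real_asymp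
          then have "\<forall>\<^sub>F k in sequentially. ?F k x = 0" by eventually_elim simp
          with False show ?thesis by (simp add: tendsto_eventually)
        qed simp
      qed
      show "AE x in lborel. norm (f x * ?F k x) \<le> norm (f x)" for k
        by (intro AE_I2) (auto simp: norm_mult infdist_nonneg intro!: mult_left_le)
      show "(\<lambda>x. f x * indicator S x) \<in> borel_measurable lborel"
        using S by (intro borel_measurable_times borel_measurable_indicator) auto
      have "continuous_on UNIV (\<lambda>x. ?F k x)" for k by (intro continuous_intros)
      then have [measurable]: "?F k \<in> borel_measurable borel" for k
        by (rule borel_measurable_continuous_onI)
      show "(\<lambda>x. f x * ?F k x) \<in> borel_measurable lborel" for k by measurable
    qed
    then have "(LINT x|lborel. f x * indicator S x) = 0"
      unfolding z by (simp add: LIMSEQ_const_iff)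
    moreover have "f x * indicator S x = indicator S x *\<^sub>R f x" for x
      by (simp add: indicator_def)
    ultimately show ?thesis by (simp add: set_lebesgue_integral_def)
  qed (simp add: set_lebesgue_integral_def)
  have si: "set_integrable lborel A f" if "A \<in> sets borel" for A
    using f that unfolding set_integrable_def by (intro integrable_mult_indicator) auto
  have sb: "sets borel = sigma_sets UNIV (Collect closed :: 'a set set)"
    by (subst borel_eq_closed) simp
  fix A :: "'a set" assume "A \<in> sets lborel"
  have "Int_stable (Collect closed :: 'a set set)" by (auto simp: Int_stable_def)
  moreover have "Collect closed \<subseteq> Pow (UNIV :: 'a set)" by simp
  moreover have "A \<in> sigma_sets UNIV (Collect closed)"
    using \<open>A \<in> sets lborel\<close> by (simp add: sb[symmetric])
  ultimately show "(LINT x:A|lborel. f x) = 0"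
  proof (induction rule: sigma_sets_induct_disjoint)
    case (compl A)
    then have A: "A \<in> sets borel" by (simp add: sb)
    have "(LINT x:(UNIV - A) \<union> A|lborel. f x) = (LINT x:UNIV - A|lborel. f x) + (LINT x:A|lborel. f x)"
      using A by (intro set_integral_Un si) auto
    moreover have "(UNIV - A) \<union> A = UNIV" by auto
    \<comment> \<open>The complement step needs the integral over the whole space to be 0, which is
      the closed case for \<open>UNIV\<close>.\<close>
    ultimately show ?case using compl closed[of UNIV] by simp
  next
    case (union A)
    then have "range A \<subseteq> sets borel" by (simp add: sb)
    then have "(LINT x:(\<Union>i. A i)|lborel. f x) = (\<Sum>i. LINT x:A i|lborel. f x)"
      using union(1) by (intro lebesgue_integral_countable_add si) (auto simp: disjoint_family_on_def)
    with union show ?case by simp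
  qed (auto simp: Int_stable_def closed)
qed

section \<open>The fractional equation\<close>

lemma weighted_gaussian_le:
  fixes \<eta> \<xi> :: "'a::euclidean_space" assumes c: "0 < c"
  shows "(1 + (norm \<xi>)\<^sup>2) * gaussian c (\<xi> - \<eta>)
    \<le> (1 + 2 * (norm \<eta>)\<^sup>2) * 2 * (1 + 2 / c) * gaussian (c / 2) (\<xi> - \<eta>)"
proof -
  have "(1 + (norm \<xi>)\<^sup>2) * gaussian c (\<xi> - \<eta>)
      \<le> (1 + 2 * (norm \<eta>)\<^sup>2) * (2 * (1 + (norm (\<xi> - \<eta>))\<^sup>2)) * gaussian c (\<xi> - \<eta>)"
    using norm_square_shift_le[of \<eta> "\<xi> - \<eta>"] by (intro mult_right_mono) auto
  also have "\<dots> = (1 + 2 * (norm \<eta>)\<^sup>2) * 2 * ((1 + (norm (\<xi> - \<eta>))\<^sup>2) * gaussian c (\<xi> - \<eta>))"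
    by (simp only: mult_ac)
  also have "\<dots> \<le> (1 + 2 * (norm \<eta>)\<^sup>2) * 2 * ((1 + 2 / c) * gaussian (c / 2) (\<xi> - \<eta>))"
    by (intro mult_left_mono norm_square_gaussian_le c) auto
  finally show ?thesis by (simp only: mult_ac)
qed

text \<open>The weights used are 1, |\<xi>|^(2s) and (1 + |\<xi>|^2)^s, all below 1 + |\<xi>|^2 when
  s is at most 1. Both integrability claims matter, since the duality in \<open>fourier_L2\<close>
  accepts test functions in the intersection of L1 and L2.\<close>

lemma
  fixes m :: "'a::euclidean_space \<Rightarrow> real"
  assumes c: "0 < c" and [measurable]: "m \<in> borel_measurable borel"
    and m: "\<And>\<xi>. \<bar>m \<xi>\<bar> \<le> 1 + (norm \<xi>)\<^sup>2"
  shows L1fun_weighted_gaussian: "L1fun (\<lambda>\<xi>. complex_of_real (m \<xi> * gaussian c (\<xi> - \<eta>)))" (is ?L1)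
    and L2fun_weighted_gaussian: "L2fun (\<lambda>\<xi>. complex_of_real (m \<xi> * gaussian c (\<xi> - \<eta>)))" (is ?L2)
proof -
  define K where "K = (1 + 2 * (norm \<eta>)\<^sup>2) * 2 * (1 + 2 / c)"
  have K: "0 \<le> K" using c unfolding K_def by simp
  have le: "\<bar>m \<xi> * gaussian c (\<xi> - \<eta>)\<bar> \<le> K * gaussian (c / 2) (\<xi> - \<eta>)" for \<xi>
  proof -
    have "\<bar>m \<xi> * gaussian c (\<xi> - \<eta>)\<bar> \<le> (1 + (norm \<xi>)\<^sup>2) * gaussian c (\<xi> - \<eta>)"
      using m[of \<xi>] by (simp add: abs_mult mult_right_mono)
    also have "\<dots> \<le> K * gaussian (c / 2) (\<xi> - \<eta>)"
      unfolding K_def by (rule weighted_gaussian_le[OF c])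
    finally show ?thesis .
  qed
  have sq: "(m \<xi> * gaussian c (\<xi> - \<eta>))\<^sup>2 \<le> K\<^sup>2 * gaussian c (\<xi> - \<eta>)" for \<xi>
  proof -
    have "(m \<xi> * gaussian c (\<xi> - \<eta>))\<^sup>2 \<le> (K * gaussian (c / 2) (\<xi> - \<eta>))\<^sup>2"
      using power_mono[OF le[of \<xi>], of 2] by simp
    also have "\<dots> = K\<^sup>2 * gaussian c (\<xi> - \<eta>)"
      by (simp add: power_mult_distrib power2_eq_square[of "gaussian _ _"] gaussian_mult)
    finally show ?thesis .
  qed
  have "0 < c / 2" using c by simp
  note i = integrable_gaussian_shift[OF this, of \<eta>]
  show ?L1 unfolding L1fun_def
    by (rule Bochner_Integration.integrable_bound[OF integrable_mult_right[OF i, of K]])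
      (use le K in \<open>auto simp: norm_mult abs_mult\<close>)
  show ?L2 unfolding L2fun_def
  proof
    show "integrable lborel (\<lambda>\<xi>. (norm (complex_of_real (m \<xi> * gaussian c (\<xi> - \<eta>))))\<^sup>2)"
      by (rule Bochner_Integration.integrable_bound[OF integrable_mult_right[OF integrable_gaussian_shift[OF c, of \<eta>], of "K\<^sup>2"]])
        (use sq K in \<open>auto simp: norm_mult abs_mult power_mult_distrib\<close>)
  qed measurable
qed

text \<open>The test function is designed from the frequency side: the rate \<open>d\<close> and the
  normalising constant are chosen so that its transform is exactly the translated Gaussian of rate
  c.\<close>

lemma Hs_fourier_gaussian:
  fixes \<eta> :: "'a::euclidean_space"
  assumes c: "0 < c" and s: "0 \<le> s" "s \<le> 1"
  defines "d \<equiv> 1 / (4 * c)"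
  shows "Hs_fourier s (\<lambda>x. complex_of_real (gaussian d x) * cis (x \<bullet> \<eta>) / complex_of_real (sqrt (pi / d) ^ DIM('a)))
    (\<lambda>\<xi>. complex_of_real (gaussian c (\<xi> - \<eta>)))" (is "Hs_fourier s ?\<phi> ?w")
proof -
  have d: "0 < d" using c by (simp add: d_def)
  define k where "k = sqrt (pi / d) ^ DIM('a)"
  have k: "0 < k" using d by (simp add: k_def)
  have n: "norm (?\<phi> x) = gaussian d x / k" for x
    using k by (simp add: norm_mult norm_divide k_def[symmetric])
  have m: "?\<phi> \<in> borel_measurable borel" by measurable
  have L1: "integrable lborel ?\<phi>"
    by (rule Bochner_Integration.integrable_bound[OF integrable_divide[OF integrable_gaussian[OF d], of k]])
      (use m n k in auto)
  have "integrable lborel (\<lambda>x. (norm (?\<phi> x))\<^sup>2)"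
  proof -
    have "(norm (?\<phi> x))\<^sup>2 = gaussian (2 * d) x / k\<^sup>2" for x
      unfolding n by (simp add: power_divide power2_eq_square[of "gaussian _ _"] gaussian_mult)
    moreover have "0 < 2 * d" using d by simp
    ultimately show ?thesis
      by (simp only: integrable_divide[OF integrable_gaussian])
  qed
  with m have L2: "L2fun ?\<phi>" by (simp add: L2fun_def)
  have Lw: "L1fun ?w" "L2fun ?w"
    using L1fun_weighted_gaussian[OF c, of "\<lambda>_. 1" \<eta>] L2fun_weighted_gaussian[OF c, of "\<lambda>_. 1" \<eta>] by simp_all
  have \<phi>w: "fourier_L1 ?\<phi> \<xi> = ?w \<xi>" for \<xi>
  proof -
    have "fourier_L1 ?\<phi> \<xi> = fourier_L1 (\<lambda>x. complex_of_real (gaussian d x) * cis (x \<bullet> \<eta>)) \<xi> / complex_of_real k"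
      unfolding fourier_L1_def k_def[symmetric] by (simp only: times_divide_eq_left integral_divide_zero)
    then show ?thesis
      using c k unfolding fourier_L1_gaussian_modulated[OF d] k_def[symmetric] by (simp add: d_def)
  qed
  have "fourier_L2 ?\<phi> ?w"
    unfolding fourier_L2_def using L2 Lw fourier_L1_duality[OF L1, unfolded \<phi>w]
    by (auto simp only: L1fun_def)
  moreover have "integrable lborel (\<lambda>\<xi>. (1 + (norm \<xi>)\<^sup>2) powr s * (norm (?w \<xi>))\<^sup>2)"
  proof -
    have "\<bar>(1 + (norm \<xi>)\<^sup>2) powr s\<bar> \<le> 1 + (norm \<xi>)\<^sup>2" for \<xi> :: 'a
      using powr_mono[OF s(2), of "1 + (norm \<xi>)\<^sup>2"] by simp
    then have "L1fun (\<lambda>\<xi>. complex_of_real ((1 + (norm \<xi>)\<^sup>2) powr s * gaussian (2 * c) (\<xi> - \<eta>)))"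
      using c by (intro L1fun_weighted_gaussian) auto
    then have "integrable lborel (\<lambda>\<xi>. (1 + (norm \<xi>)\<^sup>2) powr s * gaussian (2 * c) (\<xi> - \<eta>))"
      unfolding L1fun_def by (simp only: complex_of_real_integrable_eq)
    then show ?thesis
      by (simp add: power2_eq_square[of "gaussian _ _"] gaussian_mult)
  qed
  ultimately show ?thesis by (simp add: Hs_fourier_def)
qed

text \<open>Testing with Gaussians centred at \<xi> makes the integrals of the continuous function
  \<open>?h\<close> against them vanish; letting their width shrink gives
  \<open>?h \<xi> = 0\<close> itself.\<close>

lemma weak_solution_fourier_eq:
  fixes q u :: "'a::euclidean_space \<Rightarrow> complex"
  assumes s: "0 < s" "s \<le> 1" and u: "integrable lborel u" and g: "integrable lborel (\<lambda>x. q x * u x)"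
    and Hs: "in_Hs s u" and weak: "frac_weak_solution s q u"
  shows "complex_of_real (norm \<xi> powr (2 * s)) * fourier_L1 u \<xi> + fourier_L1 (\<lambda>x. q x * u x) \<xi> = 0"
proof -
  let ?m = "\<lambda>\<xi>::'a. norm \<xi> powr (2 * s)"
  let ?g = "\<lambda>x. q x * u x"
  let ?h = "\<lambda>\<xi>. complex_of_real (?m \<xi>) * fourier_L1 u \<xi> + fourier_L1 ?g \<xi>"
  obtain v where v: "Hs_fourier s u v" using Hs by (auto simp: in_Hs_def)
  have [measurable]: "fourier_L1 u \<in> borel_measurable borel" "fourier_L1 ?g \<in> borel_measurable borel"
    using u g by (auto intro: borel_measurable_fourier_L1)
  have m: "?m \<xi> \<le> 1 + (norm \<xi>)\<^sup>2" for \<xi>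
  proof (cases "norm \<xi> \<le> 1")
    case True
    then have "?m \<xi> \<le> 1" using s by (intro powr_le1) auto
    then show ?thesis by (simp add: add_increasing2)
  next
    case False
    then have "?m \<xi> \<le> norm \<xi> powr 2" using s by (intro powr_mono) auto
    with False show ?thesis by simp
  qed
  \<comment> \<open>The duality defining the Plancherel transform, applied to the weight times a Gaussian, replaces \<open>v\<close> by
    the \<open>L\<^sup>1\<close> transform of \<open>u\<close>; no almost-everywhere identification of the two is needed.\<close>
  have test: "(LINT \<xi>|lborel. ?h \<xi> * complex_of_real (gaussian c (\<xi> - \<eta>))) = 0" if c: "0 < c" for c \<eta>
  proof -
    define d where "d = 1 / (4 * c)"
    have d: "0 < d" using c by (simp add: d_def)
    let ?w = "\<lambda>\<xi>. complex_of_real (gaussian c (\<xi> - \<eta>))"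
    let ?\<psi> = "\<lambda>\<xi>. complex_of_real (?m \<xi> * gaussian c (\<xi> - \<eta>))"
    let ?\<phi> = "\<lambda>x. complex_of_real (gaussian d x) * cis (x \<bullet> \<eta>) / complex_of_real (sqrt (pi / d) ^ DIM('a))"
    have dual: "(LINT x|lborel. u x * fourier_L1 f x) = (LINT \<xi>|lborel. v \<xi> * f \<xi>)"
      if "L1fun f" "L2fun f" for f
      using v that by (auto simp only: Hs_fourier_def fourier_L2_def)
    have \<psi>: "L1fun ?\<psi>" "L2fun ?\<psi>"
      by (rule L1fun_weighted_gaussian L2fun_weighted_gaussian; use m c in simp)+
    have w: "integrable lborel ?w"
      using integrable_gaussian_shift[OF c, of \<eta>] by (simp only: complex_of_real_integrable_eq)
    have "(LINT \<xi>|lborel. complex_of_real (?m \<xi>) * v \<xi> * cnj (?w \<xi>)) = (LINT \<xi>|lborel. v \<xi> * ?\<psi> \<xi>)"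
      by (simp add: mult_ac)
    also have "\<dots> = (LINT x|lborel. u x * fourier_L1 ?\<psi> x)"
      by (rule dual[OF \<psi>, symmetric])
    also have "\<dots> = (LINT \<xi>|lborel. fourier_L1 u \<xi> * ?\<psi> \<xi>)"
      using u \<psi> by (intro fourier_L1_duality) (auto simp: L1fun_def)
    finally have 1: "(LINT \<xi>|lborel. complex_of_real (?m \<xi>) * v \<xi> * cnj (?w \<xi>)) = (LINT \<xi>|lborel. fourier_L1 u \<xi> * ?\<psi> \<xi>)" .
    \<comment> \<open>Fourier inversion for one Gaussian: 4 c d = 1 gives sqrt(pi/c) sqrt(pi/d) = 2
      pi. The resulting power of 2 pi is the one in the weak formulation, so it factors out and
      cancels.\<close>
    have cnj\<phi>: "cnj (?\<phi> x) = fourier_L1 ?w x * complex_of_real (1 / (2 * pi) ^ DIM('a))" for x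
    proof -
      have "(pi / c) * (pi / d) = (2 * pi)\<^sup>2"
        using c by (simp add: d_def power2_eq_square)
      then have "sqrt (pi / c) * sqrt (pi / d) = 2 * pi"
        by (simp only: real_sqrt_mult[symmetric] real_sqrt_abs) simp
      then have "sqrt (pi / c) ^ DIM('a) * sqrt (pi / d) ^ DIM('a) = (2 * pi) ^ DIM('a)"
        by (simp only: power_mult_distrib[symmetric])
      then have "1 / sqrt (pi / d) ^ DIM('a) = sqrt (pi / c) ^ DIM('a) * (1 / (2 * pi) ^ DIM('a))"
        using d by (simp add: divide_simps del: real_sqrt_divide)
      then have "complex_of_real (gaussian d x / sqrt (pi / d) ^ DIM('a)) =
          complex_of_real (sqrt (pi / c) ^ DIM('a) * gaussian d x) * complex_of_real (1 / (2 * pi) ^ DIM('a))"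
        unfolding of_real_mult[symmetric] of_real_eq_iff by (metis mult.assoc mult.commute mult.right_neutral times_divide_eq_right)
      moreover have "cnj (?\<phi> x) = complex_of_real (gaussian d x / sqrt (pi / d) ^ DIM('a)) * cis (- (x \<bullet> \<eta>))"
        by (simp add: cis_cnj)
      ultimately show ?thesis
        unfolding fourier_L1_gaussian_shift[OF c] d_def[symmetric] by (simp only: mult_ac)
    qed
    have "(LINT x|lborel. q x * u x * cnj (?\<phi> x)) = (LINT x|lborel. (?g x * fourier_L1 ?w x) * complex_of_real (1 / (2 * pi) ^ DIM('a)))"
      unfolding cnj\<phi> by (simp only: mult.assoc)
    also have "\<dots> = complex_of_real (1 / (2 * pi) ^ DIM('a)) * (LINT \<xi>|lborel. fourier_L1 ?g \<xi> * ?w \<xi>)"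
      unfolding integral_mult_left_zero fourier_L1_duality[OF g w] by (rule mult.commute)
    finally have 2: "(LINT x|lborel. q x * u x * cnj (?\<phi> x)) = complex_of_real (1 / (2 * pi) ^ DIM('a)) * (LINT \<xi>|lborel. fourier_L1 ?g \<xi> * ?w \<xi>)" .
    have "Hs_fourier s ?\<phi> ?w"
      unfolding d_def using s by (intro Hs_fourier_gaussian c) auto
    with weak v have "complex_of_real (1 / (2 * pi) ^ DIM('a)) * (LINT \<xi>|lborel. complex_of_real (?m \<xi>) * v \<xi> * cnj (?w \<xi>))
        + (LINT x|lborel. q x * u x * cnj (?\<phi> x)) = 0"
      unfolding frac_weak_solution_def by blast
    then have "complex_of_real (1 / (2 * pi) ^ DIM('a)) * ((LINT \<xi>|lborel. fourier_L1 u \<xi> * ?\<psi> \<xi>) + (LINT \<xi>|lborel. fourier_L1 ?g \<xi> * ?w \<xi>)) = 0"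
      unfolding 1 2 by (simp only: distrib_left)
    then have "(LINT \<xi>|lborel. fourier_L1 u \<xi> * ?\<psi> \<xi>) + (LINT \<xi>|lborel. fourier_L1 ?g \<xi> * ?w \<xi>) = 0"
      by simp
    moreover have bdd: "integrable lborel (\<lambda>\<xi>. fourier_L1 f \<xi> * k \<xi>)"
      if f: "integrable lborel f" and k: "integrable lborel k" for f k :: "'a \<Rightarrow> complex"
    proof (rule Bochner_Integration.integrable_bound)
      let ?M = "LINT x|lborel. norm (f x)"
      show "integrable lborel (\<lambda>\<xi>. ?M * norm (k \<xi>))" using k by simp
      show "AE \<xi> in lborel. norm (fourier_L1 f \<xi> * k \<xi>) \<le> norm (?M * norm (k \<xi>))"
      proof (rule AE_I2)
        fix \<xi>
        have "norm (fourier_L1 f \<xi> * k \<xi>) \<le> ?M * norm (k \<xi>)"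
          unfolding norm_mult by (intro mult_right_mono norm_fourier_L1_le) simp
        also have "\<dots> \<le> norm (?M * norm (k \<xi>))" by simp
        finally show "norm (fourier_L1 f \<xi> * k \<xi>) \<le> norm (?M * norm (k \<xi>))" .
      qed
      show "(\<lambda>\<xi>. fourier_L1 f \<xi> * k \<xi>) \<in> borel_measurable lborel"
        using borel_measurable_fourier_L1[OF f] borel_measurable_integrable[OF k] by measurable
    qed
    have "(LINT \<xi>|lborel. fourier_L1 u \<xi> * ?\<psi> \<xi>) + (LINT \<xi>|lborel. fourier_L1 ?g \<xi> * ?w \<xi>)
        = (LINT \<xi>|lborel. fourier_L1 u \<xi> * ?\<psi> \<xi> + fourier_L1 ?g \<xi> * ?w \<xi>)"
      using bdd[OF u, of ?\<psi>] bdd[OF g w] \<psi> by (intro Bochner_Integration.integral_add[symmetric]) (auto simp: L1fun_def)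
    ultimately show ?thesis by (simp add: algebra_simps)
  qed
  let ?M = "(LINT x|lborel. norm (u x)) + (LINT x|lborel. norm (?g x))"
  have "(\<lambda>n. LINT z|lborel. ?h (\<xi> + (1 / real (Suc n)) *\<^sub>R z) * complex_of_real (gaussian 1 z))
    \<longlonglongrightarrow> ?h \<xi> * complex_of_real (sqrt pi ^ DIM('a))"
  proof (rule gaussian_approximate_identity)
    \<comment> \<open>At the origin, continuity of the weight rests on the positive exponent
      2s.\<close>
    have "isCont (\<lambda>\<xi>::'a. complex_of_real (?m \<xi>)) \<xi>"
      unfolding isCont_def using s by (auto intro!: tendsto_intros tendsto_powr')
    then show "isCont ?h \<xi>"
      by (intro continuous_add continuous_mult isCont_fourier_L1 u g)
    fix y :: 'a
    have "norm (?h y) \<le> ?m y * norm (fourier_L1 u y) + norm (fourier_L1 ?g y)"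
      using norm_triangle_ineq[of "complex_of_real (?m y) * fourier_L1 u y" "fourier_L1 ?g y"]
      by (simp add: norm_mult)
    also have "\<dots> \<le> (1 + (norm y)\<^sup>2) * (LINT x|lborel. norm (u x)) + (1 + (norm y)\<^sup>2) * (LINT x|lborel. norm (?g x))"
    proof (intro add_mono mult_mono m norm_fourier_L1_le)
      have "norm (fourier_L1 ?g y) \<le> 1 * (LINT x|lborel. norm (?g x))"
        using norm_fourier_L1_le[of ?g y] by simp
      also have "\<dots> \<le> (1 + (norm y)\<^sup>2) * (LINT x|lborel. norm (?g x))"
        by (intro mult_right_mono integral_nonneg_AE) auto
      finally show "norm (fourier_L1 ?g y) \<le> (1 + (norm y)\<^sup>2) * (LINT x|lborel. norm (?g x))" .
    qed auto
    finally show "norm (?h y) \<le> ?M * (1 + (norm y)\<^sup>2)" by (subst distrib_right) (simp only: mult.commute)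
  qed measurable
  moreover have "(LINT z|lborel. ?h (\<xi> + (1 / real (Suc n)) *\<^sub>R z) * complex_of_real (gaussian 1 z)) = 0" for n
  proof -
    let ?r = "1 / real (Suc n)"
    have "0 < ?r" "0 < 1 / ?r\<^sup>2" by simp_all
    moreover have "?h \<in> borel_measurable borel" by measurable
    ultimately show ?thesis
      using integral_gaussian_rescale[of ?h ?r \<xi>] test[of "1 / ?r\<^sup>2" \<xi>] by simp
  qed
  ultimately have "?h \<xi> * complex_of_real (sqrt pi ^ DIM('a)) = 0"
    by (simp only: LIMSEQ_const_iff)
  then show ?thesis by simp
qed

theorem theorem1p2:
  fixes s \<alpha> C :: real and q u :: "'a::euclidean_space \<Rightarrow> complex"
  assumes "1/4 < s" and "s < 1"
    and "q \<in> borel_measurable lborel" and "AE x in lborel. norm (q x) \<le> 1"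
    and "in_Hs s u"
    and "frac_weak_solution s q u"
    and "\<alpha> > 4 * s / (4 * s - 1)"
    and "(\<integral>\<^sup>+ x. ennreal (exp (norm x powr \<alpha>) * (norm (u x))\<^sup>2) \<partial>lborel) \<le> ennreal C"
  shows "AE x in lborel. u x = 0"
proof -
  let ?g = "\<lambda>x. q x * u x"
  \<comment> \<open>The denominator is positive because s > 1/4, and it is smaller than the
    numerator.\<close>
  have "1 < 4 * s / (4 * s - 1)" using assms(1) by (simp add: field_simps)
  with assms(7) have \<alpha>: "1 < \<alpha>" by linarith
  have [measurable]: "u \<in> borel_measurable borel" "q \<in> borel_measurable borel"
    using assms(3,5) by (auto simp: in_Hs_def Hs_fourier_def fourier_L2_def L2fun_def)
  have "integrable lborel (\<lambda>x. exp (norm x powr \<alpha>) * (norm (u x))\<^sup>2)"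
  proof (rule integrableI_bounded)
    have "(\<integral>\<^sup>+ x. ennreal (exp (norm x powr \<alpha>) * (norm (u x))\<^sup>2) \<partial>lborel) < \<infinity>"
      using le_less_trans[OF assms(8) ennreal_less_top] by simp
    then show "(\<integral>\<^sup>+ x. ennreal (norm (exp (norm x powr \<alpha>) * (norm (u x))\<^sup>2)) \<partial>lborel) < \<infinity>"
      by (simp add: abs_mult)
  qed measurable
  then have du: "integrable lborel (\<lambda>x. exp (r * norm x) * norm (u x))" for r
    by (intro superexponential_decay_integrable[OF _ \<alpha>]) auto
  have dg: "integrable lborel (\<lambda>x. exp (r * norm x) * norm (?g x))" for r
  proof (rule Bochner_Integration.integrable_bound[OF du[of r]])
    show "AE x in lborel. norm (exp (r * norm x) * norm (?g x)) \<le> norm (exp (r * norm x) * norm (u x))"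
      using assms(4)
    proof eventually_elim
      case (elim x)
      then have "norm (q x) * norm (u x) \<le> 1 * norm (u x)" by (intro mult_right_mono) auto
      then show ?case by (simp add: norm_mult abs_mult)
    qed
  qed measurable
  have u: "integrable lborel u" and g: "integrable lborel ?g"
    using du[of 0] dg[of 0] by (auto simp: integrable_norm_iff)
  have eq: "complex_of_real (norm \<xi> powr (2 * s)) * fourier_L1 u \<xi> + fourier_L1 ?g \<xi> = 0" for \<xi>
    using assms(1,2) by (intro weak_solution_fourier_eq u g assms) auto
  \<comment> \<open>For a unit vector \<omega> the norm of t \<omega> is |t|, so on this line the
    symbol becomes the one-variable factor |t|^(2s).\<close>
  have nz: "fourier_L1 u (t *\<^sub>R \<omega>) = 0" if "norm \<omega> = 1" for t \<omega>
  proof -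
    obtain a b where "\<And>t. (\<lambda>k. a k * of_real t ^ k) sums fourier_L1 u (t *\<^sub>R \<omega>)"
      "\<And>t. (\<lambda>k. b k * of_real t ^ k) sums fourier_L1 ?g (t *\<^sub>R \<omega>)"
      using fourier_L1_power_series[OF _ du] fourier_L1_power_series[OF _ dg] by auto metis
    moreover have "complex_of_real (\<bar>t\<bar> powr (2 * s)) * fourier_L1 u (t *\<^sub>R \<omega>) + fourier_L1 ?g (t *\<^sub>R \<omega>) = 0" for t
      using eq[of "t *\<^sub>R \<omega>"] that by simp
    ultimately show ?thesis
      using assms(1,2) by (intro fractional_power_times_power_series_zero[where s=s]) auto
  qed
  have "fourier_L1 u \<xi> = 0" for \<xi>
  proof -
    obtain b :: 'a where b: "b \<in> Basis" using nonempty_Basis by blast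
    show ?thesis
    \<comment> \<open>Since \<open>sgn 0 = 0\<close> is not a unit vector, the origin is reached
      along a basis vector at t = 0.\<close>
    proof (cases "\<xi> = 0")
      case True
      then show ?thesis using nz[of b 0] b by simp
    next
      case False
      then show ?thesis using nz[of "sgn \<xi>" "norm \<xi>"] by (simp add: norm_sgn sgn_div_norm)
    qed
  qed
  then show ?thesis by (rule fourier_L1_eq_0_imp_AE_0[OF u])
qed

end
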